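(* Let $a>1$ and $b\in\mathbb{C}$ be such that $C_{az+b}$ is a bounded composition operator on $\mathcal{H}(\beta,\Lambda)$, and suppose that $(\lambda_n)_{n\ge1}$ has precisely one zero and one non-zero initial point with respect to $a$. Let $w_j=\prod_{k=2}^{j+1}r_k(a,b)$ for $j\ge1$. Assume that $(w_j^{-1})_{j\ge1}\notin\ell^2$. Then $C_{az+b}$ is cyclic.
   Context: $\mathbb{N}=\{1,2,\dots\}$. $\Lambda=(\lambda_n)_{n\ge1}$ is a strictly increasing sequence of non-negative real numbers tending to $\infty$ with $L:=\limsup_{n\to\infty}\frac{\log n}{\lambda_n}<\infty$. $\beta=(\beta_n)_{n\ge1}$ is a sequence of positive real numbers with $\beta_*:=\liminf_{n\to\infty}\frac{\log\beta_n}{\lambda_n}\neq\pm\infty$. For $r\in\mathbb{R}$, $\mathbb{C}_r=\{z\in\mathbb{C}:\operatorname{Re}(z)>r\}$. $\mathcal{H}(\beta,\Lambda)$ is the space of Dirichlet series $f(z)=\sum_{n=1}^\infty a_ne^{-\lambda_nz}$ with $\sum_{n=1}^\infty|a_n|^2\beta_n^2<\infty$; such series converge to holomorphic functions on $\mathbb{C}_{L/2-\beta_*}$, their coefficients are uniquely determined by $f$, and $\mathcal{H}(\beta,\Lambda)$ is a Hilbert space with inner product $\langle f,g\rangle=\sum_{n}a_n\overline{b_n}\beta_n^2$. $C_\varphi f=f\circ\varphi$ ($C_{az+b}$ is $C_\varphi$ for $\varphi(z)=az+b$); "$C_\varphi$ is a bounded composition operator on $\mathcal{H}(\beta,\Lambda)$"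 means that $\varphi$ is a holomorphic self-map of $\mathbb{C}_{L/2-\beta_*}$ and $C_\varphi$ maps $\mathcal{H}(\beta,\Lambda)$ into itself boundedly. If $C_{az+b}$ is bounded with $a>1$, then for every $n\in\mathbb{N}$ there is a unique index $m_n\ge n$ with $a\lambda_n=\lambda_{m_n}$; set $r_n(a,b)=e^{-\lambda_nb}\frac{\beta_{m_n}}{\beta_n}$. A term $\lambda_k$ is an initial point with respect to $a$ if there is no $n<k$ such that $a^s\lambda_n=\lambda_k$ for some $s\in\mathbb{N}$. Having precisely one zero and one non-zero initial point means that $\lambda_1=0$ and $\lambda_n=\lambda_2a^{n-2}$ for $n\ge2$. A bounded operator $T$ on a Hilbert space $\mathcal{H}$ is cyclic if there is $x\in\mathcal{H}$ such that the linear span of $\operatorname{Orb}(T,x)=\{T^nx:n=0,1,2,\dots\}$ is dense in $\mathcal{H}$. *)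

theory Defs
  imports "HOL-Complex_Analysis.Complex_Analysis"
begin

text \<open>
  Sequences are indexed by the positive integers: a sequence is a function on \<^typ>\<open>nat\<close> whose value
  at \<open>0\<close> is never used, and a series over \<open>n \<ge> 1\<close> is written with \<^const>\<open>Suc\<close>.
\<close>

definition L_upper :: "(nat \<Rightarrow> real) \<Rightarrow> ereal" where
  "L_upper \<Lambda> = limsup (\<lambda>n. ereal (ln (real n) / \<Lambda> n))"

definition beta_star :: "(nat \<Rightarrow> real) \<Rightarrow> (nat \<Rightarrow> real) \<Rightarrow> ereal" where
  "beta_star \<beta> \<Lambda> = liminf (\<lambda>n. ereal (ln (\<beta> n) / \<Lambda> n))"

definition half_plane :: "real \<Rightarrow> complex set" where
  "half_plane r = {z. Re z > r}"

text \<open>The common half-plane of convergence; used only when both limits are finite.\<close>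

definition dir_domain :: "(nat \<Rightarrow> real) \<Rightarrow> (nat \<Rightarrow> real) \<Rightarrow> complex set" where
  "dir_domain \<beta> \<Lambda> =
     half_plane (real_of_ereal (L_upper \<Lambda>) / 2 - real_of_ereal (beta_star \<beta> \<Lambda>))"

text \<open>
  A function on the half-plane is represented by its extension by zero to all of \<^typ>\<open>complex\<close>, so
  that equality of elements of the space is equality of functions on the half-plane.  The
  normalisation \<open>c 0 = 0\<close> makes the coefficient sequence, which is determined at indices \<open>n \<ge> 1\<close>,
  unique as a function on \<^typ>\<open>nat\<close>.
\<close>

definition is_dir_coeffs ::
    "(nat \<Rightarrow> real) \<Rightarrow> (nat \<Rightarrow> real) \<Rightarrow> (complex \<Rightarrow> complex) \<Rightarrow> (nat \<Rightarrow> complex) \<Rightarrow> bool" where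
  "is_dir_coeffs \<beta> \<Lambda> f c \<longleftrightarrow>
     c 0 = 0 \<and>
     summable (\<lambda>n. (cmod (c (Suc n)))\<^sup>2 * (\<beta> (Suc n))\<^sup>2) \<and>
     (\<forall>z\<in>dir_domain \<beta> \<Lambda>.
        (\<lambda>n. c (Suc n) * exp (- (of_real (\<Lambda> (Suc n)) * z))) sums f z) \<and>
     (\<forall>z. z \<notin> dir_domain \<beta> \<Lambda> \<longrightarrow> f z = 0)"

definition dir_space :: "(nat \<Rightarrow> real) \<Rightarrow> (nat \<Rightarrow> real) \<Rightarrow> (complex \<Rightarrow> complex) set" where
  "dir_space \<beta> \<Lambda> = {f. \<exists>c. is_dir_coeffs \<beta> \<Lambda> f c}"

definition dir_coeff ::
    "(nat \<Rightarrow> real) \<Rightarrow> (nat \<Rightarrow> real) \<Rightarrow> (complex \<Rightarrow> complex) \<Rightarrow> nat \<Rightarrow> complex" where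
  "dir_coeff \<beta> \<Lambda> f = (THE c. is_dir_coeffs \<beta> \<Lambda> f c)"

definition dir_inner ::
    "(nat \<Rightarrow> real) \<Rightarrow> (nat \<Rightarrow> real) \<Rightarrow> (complex \<Rightarrow> complex) \<Rightarrow> (complex \<Rightarrow> complex) \<Rightarrow> complex" where
  "dir_inner \<beta> \<Lambda> f g =
     (\<Sum>n. dir_coeff \<beta> \<Lambda> f (Suc n) * cnj (dir_coeff \<beta> \<Lambda> g (Suc n)) * of_real ((\<beta> (Suc n))\<^sup>2))"

definition dir_norm ::
    "(nat \<Rightarrow> real) \<Rightarrow> (nat \<Rightarrow> real) \<Rightarrow> (complex \<Rightarrow> complex) \<Rightarrow> real" where
  "dir_norm \<beta> \<Lambda> f = sqrt (Re (dir_inner \<beta> \<Lambda> f f))"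

definition comp_op ::
    "complex set \<Rightarrow> (complex \<Rightarrow> complex) \<Rightarrow> (complex \<Rightarrow> complex) \<Rightarrow> complex \<Rightarrow> complex" where
  "comp_op D \<phi> f = (\<lambda>z. if z \<in> D then f (\<phi> z) else 0)"

definition bounded_comp_op ::
    "(nat \<Rightarrow> real) \<Rightarrow> (nat \<Rightarrow> real) \<Rightarrow> (complex \<Rightarrow> complex) \<Rightarrow> bool" where
  "bounded_comp_op \<beta> \<Lambda> \<phi> \<longleftrightarrow>
     \<phi> holomorphic_on dir_domain \<beta> \<Lambda> \<and>
     \<phi> ` dir_domain \<beta> \<Lambda> \<subseteq> dir_domain \<beta> \<Lambda> \<and>
     comp_op (dir_domain \<beta> \<Lambda>) \<phi> ` dir_space \<beta> \<Lambda> \<subseteq> dir_space \<beta> \<Lambda> \<and>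
     (\<exists>K. \<forall>f\<in>dir_space \<beta> \<Lambda>.
        dir_norm \<beta> \<Lambda> (comp_op (dir_domain \<beta> \<Lambda>) \<phi> f) \<le> K * dir_norm \<beta> \<Lambda> f)"

definition affine_symbol :: "real \<Rightarrow> complex \<Rightarrow> complex \<Rightarrow> complex" where
  "affine_symbol a b = (\<lambda>z. of_real a * z + b)"

definition orbit_index :: "(nat \<Rightarrow> real) \<Rightarrow> real \<Rightarrow> nat \<Rightarrow> nat" where
  "orbit_index \<Lambda> a n = (THE m. n \<le> m \<and> a * \<Lambda> n = \<Lambda> m)"

definition r_weight ::
    "(nat \<Rightarrow> real) \<Rightarrow> (nat \<Rightarrow> real) \<Rightarrow> real \<Rightarrow> complex \<Rightarrow> nat \<Rightarrow> complex" where
  "r_weight \<beta> \<Lambda> a b n =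
     exp (- (of_real (\<Lambda> n) * b)) * of_real (\<beta> (orbit_index \<Lambda> a n) / \<beta> n)"

text \<open>\<open>is_initial \<Lambda> a k\<close>: the term \<open>\<Lambda> k\<close> is an initial point with respect to \<open>a\<close>.\<close>

definition is_initial :: "(nat \<Rightarrow> real) \<Rightarrow> real \<Rightarrow> nat \<Rightarrow> bool" where
  "is_initial \<Lambda> a k \<longleftrightarrow>
     k \<ge> 1 \<and> \<not> (\<exists>n s. 1 \<le> n \<and> n < k \<and> 1 \<le> s \<and> a ^ s * \<Lambda> n = \<Lambda> k)"

definition fun_span :: "(complex \<Rightarrow> complex) set \<Rightarrow> (complex \<Rightarrow> complex) set" where
  "fun_span S = {\<lambda>z. \<Sum>f\<in>F. c f * f z |F c. finite F \<and> F \<subseteq> S}"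

definition op_orbit ::
    "((complex \<Rightarrow> complex) \<Rightarrow> complex \<Rightarrow> complex) \<Rightarrow> (complex \<Rightarrow> complex) \<Rightarrow> (complex \<Rightarrow> complex) set" where
  "op_orbit T x = range (\<lambda>n. (T ^^ n) x)"

definition cyclic_op ::
    "(nat \<Rightarrow> real) \<Rightarrow> (nat \<Rightarrow> real) \<Rightarrow> ((complex \<Rightarrow> complex) \<Rightarrow> complex \<Rightarrow> complex) \<Rightarrow> bool" where
  "cyclic_op \<beta> \<Lambda> T \<longleftrightarrow>
     (\<exists>x\<in>dir_space \<beta> \<Lambda>. \<forall>f\<in>dir_space \<beta> \<Lambda>. \<forall>\<epsilon>>0.
        \<exists>p\<in>fun_span (op_orbit T x). dir_norm \<beta> \<Lambda> (\<lambda>z. f z - p z) < \<epsilon>)"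

end

theory Submission
  imports Defs
begin

text \<open>
  On the exponentials \<open>E\<^sub>n(z) = exp (- \<Lambda> n * z)\<close> the operator \<open>T = C\<^sub>\<phi>\<close> with \<open>\<phi>(z) = a z + b\<close> acts by
  \<open>T E\<^sub>n = exp (- \<Lambda> n * b) E\<^sub>m\<close>, where \<open>\<Lambda> m = a * \<Lambda> n\<close>.  With one zero and one non-zero initial point the
  frequencies are \<open>0\<close> and the geometric progression \<open>a\<^sup>n * \<Lambda> 2\<close>, so \<open>T\<close> fixes \<open>E\<^sub>1\<close> and shifts the others
  with weights: it is the identity on a line plus a weighted forward shift.

  The vector \<open>x = E\<^sub>1 + E\<^sub>2\<close> is cyclic.  Indeed \<open>T\<^sup>j x = E\<^sub>1 + u\<^sub>j E\<^sub>j\<^sub>+\<^sub>2\<close>, where the norm of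
  \<open>u\<^sub>j E\<^sub>j\<^sub>+\<^sub>2\<close> is \<open>\<beta> 2 * \<bar>w\<^sub>j\<bar>\<close>.  For weights \<open>t\<^sub>j\<close>, \<open>j < K\<close>, of sum \<open>1\<close>, the vector \<open>\<Sum> t\<^sub>j T\<^sup>j x\<close> lies
  at distance \<open>\<beta> 2 * sqrt (\<Sum> \<bar>t\<^sub>j\<bar>\<^sup>2 \<bar>w\<^sub>j\<bar>\<^sup>2)\<close> from \<open>E\<^sub>1\<close>.  The optimal choice, \<open>t\<^sub>j\<close> proportional to
  \<open>\<bar>w\<^sub>j\<bar>\<^sup>-\<^sup>2\<close>, makes the sum of squares equal to \<open>1 / (\<Sum>j<K. \<bar>w\<^sub>j\<bar>\<^sup>-\<^sup>2)\<close>, which tends to \<open>0\<close> because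
  \<open>(w\<^sub>j\<^sup>-\<^sup>1)\<close> is not in \<open>\<ell>\<^sup>2\<close> (with \<open>w\<^sub>0 = 1\<close>, the empty product).
  So \<open>E\<^sub>1\<close> is in the closed span of the orbit, and with it every
  \<open>E\<^sub>j\<^sub>+\<^sub>2 = u\<^sub>j\<^sup>-\<^sup>1 (T\<^sup>j x - E\<^sub>1)\<close>.  The lemma \<open>constrained_weighted_approximation\<close> carries out both steps
  at the level of coefficients.

  To work with coefficients, one needs that a Dirichlet series determines them, and that the image of
  an exponential being a Dirichlet series over \<open>\<Lambda>\<close> forces \<open>a * \<Lambda> n\<close> to be one of the frequencies.
  Both facts follow from the behaviour of the series along the positive real axis, where the term of
  smallest frequency dominates (\<open>exp_series_coeff_below\<close>, \<open>exp_series_frequency\<close>).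
\<close>

section \<open>Coefficients and frequencies of exponential series\<close>

text \<open>
  If \<open>ln n \<le> q * \<Lambda> n\<close> eventually, then \<open>exp (- 2 * q * \<Lambda> n) \<le> n\<^sup>-\<^sup>2\<close>.  Finiteness of \<open>L\<close> enters
  through this: it turns bounded terms of a Dirichlet series into absolute convergence further to the right.
\<close>

lemma summable_exp_of_L_upper:
  assumes "filterlim \<Lambda> at_top sequentially" and "L_upper \<Lambda> < \<infinity>"
  shows "\<exists>s. summable (\<lambda>n. exp (- (s * \<Lambda> (Suc n))))"
proof -
  obtain q where q: "L_upper \<Lambda> < ereal q"
    using assms(2) ereal_dense2 by blast
  have "eventually (\<lambda>n. ereal (ln (real n) / \<Lambda> n) < ereal q) sequentially"
    using q unfolding L_upper_def by (rule Limsup_lessD)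
  moreover have "eventually (\<lambda>n. \<Lambda> n > 0) sequentially"
    using assms(1) filterlim_at_top_dense by blast
  ultimately have "eventually (\<lambda>n. norm (exp (- (2 * q * \<Lambda> n))) \<le> inverse (real n ^ 2)) sequentially"
    using eventually_gt_at_top[of 0]
  proof eventually_elim
    case (elim n)
    then have "ln (real n) \<le> q * \<Lambda> n" by (simp add: field_simps)
    then have "exp (2 * ln (real n)) \<le> exp (2 * q * \<Lambda> n)" by simp
    moreover have "exp (2 * ln (real n)) = real n ^ 2"
      using elim by (simp add: exp_double)
    ultimately show ?case using elim by (simp add: exp_minus le_imp_inverse_le)
  qed
  then have "summable (\<lambda>n. exp (- (2 * q * \<Lambda> n)))"
    by (rule summable_comparison_test_ev) (rule inverse_power_summable, simp)
  then show ?thesis by (subst (asm) summable_Suc_iff[symmetric]) blast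
qed

text \<open>
  After multiplication by \<open>exp (\<mu> * x)\<close>, every term with frequency above \<open>\<mu>\<close> decays as \<open>x\<close> grows.
  Bounded terms at \<open>x0\<close> give the majorant \<open>exp (- s * l n)\<close> on \<open>x \<ge> x0 + s\<close>, so Tannery's theorem
  lets the limit be taken term by term.  The limit is a series because \<open>l\<close> may be non-injective or
  omit \<open>\<mu>\<close>; the latter case is what detects missing frequencies.
\<close>

lemma exp_series_leading_coeff:
  fixes c :: "nat \<Rightarrow> complex" and l :: "nat \<Rightarrow> real"
  assumes bnd: "\<And>n. norm (c n) * exp (- (l n * x0)) \<le> C"
    and sm: "summable (\<lambda>n. exp (- (s * l n)))"
    and low: "\<And>n. l n < \<mu> \<Longrightarrow> c n = 0"
  shows "((\<lambda>x. \<Sum>n. c n * of_real (exp (- ((l n - \<mu>) * x))))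
            \<longlongrightarrow> (\<Sum>n. if l n = \<mu> then c n else 0)) at_top"
proof -
  let ?M = "\<lambda>n. (C * exp (\<mu> * (x0 + s))) * exp (- (s * l n))"
  have lim: "((\<lambda>x. c n * of_real (exp (- ((l n - \<mu>) * x)))) \<longlongrightarrow> (if l n = \<mu> then c n else 0)) at_top"
    for n
  proof (cases "l n > \<mu>")
    case True
    have "filterlim (\<lambda>x. (l n - \<mu>) * x) at_top at_top"
      using True by (intro filterlim_tendsto_pos_mult_at_top[OF tendsto_const]) (auto simp: filterlim_ident)
    then have "((\<lambda>x. exp (- ((l n - \<mu>) * x))) \<longlongrightarrow> 0) at_top"
      by (intro filterlim_compose[OF exp_at_bot]) (simp add: filterlim_uminus_at_top)
    then have "((\<lambda>x. c n * of_real (exp (- ((l n - \<mu>) * x)))) \<longlongrightarrow> c n * of_real 0) at_top"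
      by (intro tendsto_intros)
    then show ?thesis using True by simp
  next
    case False
    then show ?thesis using low[of n] by (cases "l n = \<mu>") auto
  qed
  have bound: "norm (c n * of_real (exp (- ((l n - \<mu>) * x)))) \<le> ?M n" if x: "x \<ge> x0 + s" for n x
  proof (cases "l n < \<mu>")
    case True
    have "0 \<le> norm (c n) * exp (- (l n * x0))" by simp
    also have "\<dots> \<le> C" by (rule bnd)
    finally have "C \<ge> 0" .
    then show ?thesis using low[OF True] by simp
  next
    case False
    have "(l n - \<mu>) * (x0 + s) \<le> (l n - \<mu>) * x"
      using False x by (intro mult_left_mono) auto
    then have "norm (c n) * exp (- ((l n - \<mu>) * x)) \<le> norm (c n) * exp (- ((l n - \<mu>) * (x0 + s)))"
      by (intro mult_left_mono) auto
    also have "\<dots> = norm (c n) * exp (- (l n * x0)) * (exp (\<mu> * (x0 + s)) * exp (- (s * l n)))"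
      by (simp add: exp_add[symmetric] algebra_simps)
    also have "\<dots> \<le> C * (exp (\<mu> * (x0 + s)) * exp (- (s * l n)))"
      by (intro mult_right_mono bnd) auto
    finally show ?thesis by (simp add: norm_mult mult_ac)
  qed
  have ev: "eventually (\<lambda>(n, x). norm (c n * of_real (exp (- ((l n - \<mu>) * x)))) \<le> ?M n)
          (at_top \<times>\<^sub>F at_top)"
    unfolding eventually_prod_filter
    using bound eventually_ge_at_top[of "x0 + s"]
    by (intro exI[of _ "\<lambda>_. True"] exI[of _ "\<lambda>x. x \<ge> x0 + s"]) auto
  show ?thesis
    using tannerys_theorem[OF lim ev summable_mult[OF sm] trivial_limit_at_top_linorder] by blast
qed

text \<open>
  Multiply the identity by \<open>exp (\<mu> * x)\<close>.  The preceding lemma gives the limit of the left side, and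
  the right side \<open>C * exp (- (\<nu> - \<mu>) * x)\<close> tends to \<open>0\<close> unless \<open>\<mu> = \<nu>\<close>.
\<close>

lemma exp_series_coeff_at:
  fixes c :: "nat \<Rightarrow> complex" and l :: "nat \<Rightarrow> real"
  assumes sm: "summable (\<lambda>n. exp (- (s * l n)))"
    and ser: "\<And>x. x \<ge> x0 \<Longrightarrow> (\<lambda>n. c n * exp (- (of_real (l n) * of_real x)))
                  sums (C * exp (- (of_real \<nu> * of_real x)))"
    and low: "\<And>n. l n < \<mu> \<Longrightarrow> c n = 0" and \<mu>: "\<mu> \<le> \<nu>"
  shows "(\<Sum>n. if l n = \<mu> then c n else 0) = (if \<mu> = \<nu> then C else 0)"
proof -
  have "summable (\<lambda>n. c n * exp (- (of_real (l n) * of_real x0)))"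
    using ser[of x0] by (simp add: sums_iff)
  then obtain B where B: "\<And>n. norm (c n * exp (- (of_real (l n) * of_real x0))) \<le> B"
    using summable_imp_bounded unfolding bounded_iff by blast
  have "norm (c n) * exp (- (l n * x0)) \<le> B" for n
    using B[of n] by (simp add: norm_mult)
  then have lim1: "((\<lambda>x. \<Sum>n. c n * of_real (exp (- ((l n - \<mu>) * x))))
            \<longlongrightarrow> (\<Sum>n. if l n = \<mu> then c n else 0)) at_top"
    using sm low by (rule exp_series_leading_coeff)
  have eq: "(\<Sum>n. c n * of_real (exp (- ((l n - \<mu>) * x)))) = C * of_real (exp (- ((\<nu> - \<mu>) * x)))"
    if "x \<ge> x0" for x
  proof -
    have "(\<lambda>n. of_real (exp (\<mu> * x)) * (c n * exp (- (of_real (l n) * of_real x))))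
            sums (of_real (exp (\<mu> * x)) * (C * exp (- (of_real \<nu> * of_real x))))"
      by (intro sums_mult ser that)
    moreover have "of_real (exp (\<mu> * x)) * (u * exp (- (of_real t * of_real x)))
        = u * of_real (exp (- ((t - \<mu>) * x)))" for u :: complex and t
      by (simp add: exp_of_real[symmetric] exp_add[symmetric] algebra_simps exp_minus exp_diff divide_simps)
    ultimately show ?thesis by (simp add: sums_iff)
  qed
  have "((\<lambda>x. C * of_real (exp (- ((\<nu> - \<mu>) * x)))) \<longlongrightarrow> (if \<mu> = \<nu> then C else 0)) at_top"
  proof (cases "\<mu> = \<nu>")
    case False
    have "filterlim (\<lambda>x. (\<nu> - \<mu>) * x) at_top at_top"
      using False \<mu> by (intro filterlim_tendsto_pos_mult_at_top[OF tendsto_const]) (auto simp: filterlim_ident)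
    then have "((\<lambda>x. exp (- ((\<nu> - \<mu>) * x))) \<longlongrightarrow> 0) at_top"
      by (intro filterlim_compose[OF exp_at_bot]) (simp add: filterlim_uminus_at_top)
    then have "((\<lambda>x. C * of_real (exp (- ((\<nu> - \<mu>) * x)))) \<longlongrightarrow> C * of_real 0) at_top"
      by (intro tendsto_intros)
    then show ?thesis using False by simp
  qed auto
  moreover have "eventually (\<lambda>x. (\<Sum>n. c n * of_real (exp (- ((l n - \<mu>) * x))))
        = C * of_real (exp (- ((\<nu> - \<mu>) * x)))) at_top"
    using eventually_ge_at_top[of x0] by eventually_elim (rule eq)
  ultimately have "((\<lambda>x. \<Sum>n. c n * of_real (exp (- ((l n - \<mu>) * x))))
            \<longlongrightarrow> (if \<mu> = \<nu> then C else 0)) at_top"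
    by (simp add: tendsto_cong)
  with lim1 show ?thesis
    using tendsto_unique trivial_limit_at_top_linorder by blast
qed

text \<open>
  Compare both sides at the smallest frequency whose coefficient is not yet known to vanish.
  With \<open>C = 0\<close> and \<open>\<nu>\<close> large this is the uniqueness of Dirichlet coefficients.
\<close>

lemma exp_series_coeff_below:
  fixes c :: "nat \<Rightarrow> complex" and l :: "nat \<Rightarrow> real"
  assumes mono: "strict_mono l" and sm: "summable (\<lambda>n. exp (- (s * l n)))"
    and ser: "\<And>x. x \<ge> x0 \<Longrightarrow> (\<lambda>n. c n * exp (- (of_real (l n) * of_real x)))
                  sums (C * exp (- (of_real \<nu> * of_real x)))"
    and k: "l k < \<nu>"
  shows "c k = 0"
  using k
proof (induction k rule: less_induct)
  case (less k)
  have "c n = 0" if "l n < l k" for n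
    using less that mono by (metis order.strict_trans strict_mono_less)
  then have "(\<Sum>n. if l n = l k then c n else 0) = (if l k = \<nu> then C else 0)"
    using sm ser less.prems by (intro exp_series_coeff_at) auto
  moreover have "(\<Sum>n. if l n = l k then c n else 0) = (\<Sum>n. if n = k then c n else 0)"
    using mono by (simp add: strict_mono_eq)
  moreover have "\<dots> = c k"
    using sums_single[of k c] by (simp add: sums_iff)
  ultimately show ?case using less.prems by simp
qed

text \<open>
  All coefficients below \<open>\<nu>\<close> vanish, so the two sides may be compared at \<open>\<nu>\<close> itself.  If no
  frequency equals \<open>\<nu>\<close>, the left side contributes an empty sum where \<open>C \<noteq> 0\<close> is required.
\<close>

lemma exp_series_frequency:
  fixes c :: "nat \<Rightarrow> complex" and l :: "nat \<Rightarrow> real"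
  assumes mono: "strict_mono l" and sm: "summable (\<lambda>n. exp (- (s * l n)))"
    and ser: "\<And>x. x \<ge> x0 \<Longrightarrow> (\<lambda>n. c n * exp (- (of_real (l n) * of_real x)))
                  sums (C * exp (- (of_real \<nu> * of_real x)))"
    and C: "C \<noteq> 0"
  shows "\<exists>n. l n = \<nu>"
proof (rule ccontr)
  assume "\<not> ?thesis"
  then have "(\<Sum>n. if l n = \<nu> then c n else 0) = 0" by simp
  moreover have "(\<Sum>n. if l n = \<nu> then c n else 0) = (if \<nu> = \<nu> then C else 0)"
    using exp_series_coeff_below[OF mono sm ser]
    by (intro exp_series_coeff_at[OF sm ser]) auto
  ultimately show False using C by simp
qed

section \<open>Approximation under a linear constraint\<close>

text \<open>
  The quantitative core.  Reproduce \<open>c\<close> exactly up to an index \<open>M\<close> beyond which it is small, by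
  \<open>d\<^sub>j = c\<^sub>j / u\<^sub>j\<close>.  This violates the constraint on \<open>\<Sum> d\<^sub>j\<close> by some number \<open>A\<close>, which does not
  depend on \<open>K\<close>.  Spread \<open>A\<close> over the indices \<open>j < K\<close> in proportion to \<open>1 / (\<bar>u\<^sub>j\<bar> * B\<^sub>j)\<^sup>2\<close>: the squared cost is
  \<open>\<bar>A\<bar>\<^sup>2\<close> divided by the sum of these numbers, and this sum is unbounded in \<open>K\<close>.
\<close>

lemma constrained_weighted_approximation:
  fixes u c :: "nat \<Rightarrow> complex" and B :: "nat \<Rightarrow> real"
  assumes u: "\<And>j. u j \<noteq> 0" and B: "\<And>j. B j > 0"
    and div: "\<not> summable (\<lambda>j. 1 / (cmod (u j) * B j)\<^sup>2)"
    and sm: "summable (\<lambda>j. (cmod (c j))\<^sup>2 * (B j)\<^sup>2)" and \<epsilon>: "\<epsilon> > 0"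
  shows "\<exists>K d. (\<Sum>j<K. d j) = c0 \<and>
           (\<exists>S<\<epsilon>. (\<lambda>j. (cmod (c j - (if j < K then d j * u j else 0)))\<^sup>2 * (B j)\<^sup>2) sums S)"
proof -
  let ?g = "\<lambda>j. (cmod (c j))\<^sup>2 * (B j)\<^sup>2" and ?h = "\<lambda>j. 1 / (cmod (u j) * B j)\<^sup>2"
  have h0: "?h j > 0" for j using u B[of j] by simp
  have lim: "(\<lambda>M. \<Sum>j<M. ?g j) \<longlonglongrightarrow> suminf ?g" by (rule summable_LIMSEQ[OF sm])
  have "eventually (\<lambda>M. (\<Sum>j<M. ?g j) > suminf ?g - \<epsilon> / 4) sequentially"
    using order_tendstoD(1)[OF lim, of "suminf ?g - \<epsilon> / 4"] \<epsilon> by simp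
  then obtain M where "(\<Sum>j<M. ?g j) > suminf ?g - \<epsilon> / 4"
    using eventually_happens' sequentially_bot by blast
  then have M: "suminf ?g - (\<Sum>j<M. ?g j) < \<epsilon> / 4" by linarith
  define A where "A = c0 - (\<Sum>j<M. c j / u j)"
  (* The summand 1 keeps the sum positive when A = 0. *)
  have "\<exists>K. (\<Sum>j<K. ?h j) > 4 * (cmod A)\<^sup>2 / \<epsilon> + 1"
  proof (rule ccontr)
    assume "\<not> ?thesis"
    then have "summable ?h" using h0
      by (intro summableI_nonneg_bounded[where x = "4 * (cmod A)\<^sup>2 / \<epsilon> + 1"]) (auto simp: not_less less_imp_le)
    with div show False by blast
  qed
  then obtain K' where K': "(\<Sum>j<K'. ?h j) > 4 * (cmod A)\<^sup>2 / \<epsilon> + 1" by blast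
  define K where "K = max K' M"
  define S where "S = (\<Sum>j<K. ?h j)"
  have "(\<Sum>j<K'. ?h j) \<le> S" unfolding S_def
    using h0 by (intro sum_mono2) (auto simp: K_def less_imp_le)
  with K' have S: "S > 4 * (cmod A)\<^sup>2 / \<epsilon> + 1" by simp
  moreover have "4 * (cmod A)\<^sup>2 / \<epsilon> \<ge> 0" using \<epsilon> by simp
  ultimately have S0: "S > 0" and "4 * (cmod A)\<^sup>2 / \<epsilon> < S" by linarith+
  then have S1: "2 * (cmod A)\<^sup>2 / S < \<epsilon> / 2" using \<epsilon> by (simp add: field_simps)
  define d where "d = (\<lambda>j. (if j < M then c j / u j else 0) + A * of_real (?h j / S))"
  have "(\<Sum>j<K. d j) = (\<Sum>j<K. if j < M then c j / u j else 0) + A * of_real (\<Sum>j<K. ?h j / S)"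
    unfolding d_def by (simp only: sum.distrib sum_distrib_left of_real_sum)
  also have "(\<Sum>j<K. if j < M then c j / u j else 0) = (\<Sum>j<M. c j / u j)"
    by (rule sum.mono_neutral_cong_right) (auto simp: K_def)
  also have "(\<Sum>j<K. ?h j / S) = 1"
    using S0 unfolding sum_divide_distrib[symmetric] S_def by simp
  finally have d_sum: "(\<Sum>j<K. d j) = c0" by (simp add: A_def)
  (* The error is the tail of c minus the spread correction; expand with |p - q|^2 <= 2|p|^2 + 2|q|^2. *)
  let ?e = "\<lambda>j. (cmod (c j - (if j < K then d j * u j else 0)))\<^sup>2 * (B j)\<^sup>2"
  let ?b = "\<lambda>j. 2 * (?g j - (if j < M then ?g j else 0)) + 2 * (if j < K then (cmod A)\<^sup>2 / S\<^sup>2 * ?h j else 0)"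
  have le: "?e j \<le> ?b j" for j
  proof -
    define p where "p = (if j < M then 0 else c j)"
    define q where "q = (if j < K then A * of_real (?h j / S) * u j else 0)"
    have "c j - (if j < K then d j * u j else 0) = p - q"
      using u[of j] by (auto simp: p_def q_def d_def K_def algebra_simps)
    moreover have "(cmod (p - q))\<^sup>2 \<le> 2 * (cmod p)\<^sup>2 + 2 * (cmod q)\<^sup>2"
    proof -
      have "(cmod (p - q))\<^sup>2 \<le> (cmod p + cmod q)\<^sup>2"
        by (intro power_mono norm_triangle_ineq4) auto
      also have "\<dots> \<le> 2 * (cmod p)\<^sup>2 + 2 * (cmod q)\<^sup>2"
        using sum_squares_bound[of "cmod p" "cmod q"] by (simp add: power2_sum)
      finally show ?thesis .
    qed
    ultimately have "?e j \<le> (2 * (cmod p)\<^sup>2 + 2 * (cmod q)\<^sup>2) * (B j)\<^sup>2"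
      by (simp add: mult_right_mono)
    also have "\<dots> = 2 * ((cmod p)\<^sup>2 * (B j)\<^sup>2) + 2 * ((cmod q)\<^sup>2 * (B j)\<^sup>2)"
      by (simp add: algebra_simps)
    also have "(cmod p)\<^sup>2 * (B j)\<^sup>2 = ?g j - (if j < M then ?g j else 0)"
      by (simp add: p_def)
    also have "(cmod q)\<^sup>2 * (B j)\<^sup>2 = (if j < K then (cmod A)\<^sup>2 / S\<^sup>2 * ?h j else 0)"
    proof (cases "j < K")
      case True
      have "cmod q = cmod A * (?h j / S) * cmod (u j)"
        using True S0 h0[of j] unfolding q_def by (simp only: norm_mult norm_of_real if_True) simp
      then have "(cmod q)\<^sup>2 * (B j)\<^sup>2 = (cmod A)\<^sup>2 / S\<^sup>2 * (?h j)\<^sup>2 * (cmod (u j) * B j)\<^sup>2"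
        by (simp add: power_mult_distrib power_divide mult_ac)
      also have "\<dots> = (cmod A)\<^sup>2 / S\<^sup>2 * ?h j"
        using u[of j] B[of j] by (simp add: power2_eq_square)
      finally show ?thesis using True by simp
    qed (simp add: q_def)
    finally show ?thesis .
  qed
  have bsums: "?b sums (2 * (suminf ?g - (\<Sum>j<M. ?g j)) + 2 * (\<Sum>j<K. (cmod A)\<^sup>2 / S\<^sup>2 * ?h j))"
    using sums_If_finite_set[of "{..<M}" ?g] sums_If_finite_set[of "{..<K}" "\<lambda>j. (cmod A)\<^sup>2 / S\<^sup>2 * ?h j"]
    by (intro sums_add sums_mult sums_diff summable_sums sm) auto
  have "(\<Sum>j<K. (cmod A)\<^sup>2 / S\<^sup>2 * ?h j) = (cmod A)\<^sup>2 / S"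
    using S0 unfolding sum_distrib_left[symmetric] S_def[symmetric] by (simp add: power2_eq_square)
  then have small: "2 * (suminf ?g - (\<Sum>j<M. ?g j)) + 2 * (\<Sum>j<K. (cmod A)\<^sup>2 / S\<^sup>2 * ?h j) < \<epsilon>"
    using M S1 by simp
  have "summable ?e"
    using le by (intro summable_comparison_test'[OF sums_summable[OF bsums]]) auto
  moreover from this have "suminf ?e < \<epsilon>"
    using suminf_le[OF le _ sums_summable[OF bsums]] sums_unique[OF bsums] small by linarith
  ultimately show ?thesis using d_sum summable_sums by blast
qed

section \<open>Frequencies with one zero and one non-zero initial point\<close>

text \<open>
  The zero initial point must be \<open>\<Lambda> 1\<close>, and then \<open>\<Lambda> 2\<close> is initial because no multiple of \<open>0\<close> reaches it.
  Every later term fails to be initial, so by descent it is some \<open>a\<^sup>s * \<Lambda> 2\<close>; conversely closure under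
  multiplication by \<open>a\<close> makes every such number a term.  Two increasing enumerations of one set agree.
\<close>

lemma geometric_frequencies:
  assumes mono: "strict_mono_on {1..} \<Lambda>" and nonneg: "\<And>n. n \<ge> 1 \<Longrightarrow> \<Lambda> n \<ge> 0" and a: "a > 1"
    and closed: "\<And>k. k \<ge> 1 \<Longrightarrow> \<exists>m\<ge>1. \<Lambda> m = a * \<Lambda> k"
    and zero: "\<exists>!k. is_initial \<Lambda> a k \<and> \<Lambda> k = 0"
    and nonzero: "\<exists>!k. is_initial \<Lambda> a k \<and> \<Lambda> k \<noteq> 0"
  shows "\<Lambda> 1 = 0" and "\<Lambda> 2 > 0" and "\<Lambda> (n + 2) = a ^ n * \<Lambda> 2"
proof -
  have lt: "\<Lambda> i < \<Lambda> j \<longleftrightarrow> i < j" if "i \<ge> 1" "j \<ge> 1" for i j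
    using strict_mono_on_less[OF mono] that by simp
  have le: "\<Lambda> i \<le> \<Lambda> j \<longleftrightarrow> i \<le> j" if "i \<ge> 1" "j \<ge> 1" for i j
    using lt that by (meson linorder_not_less)
  obtain k where k: "k \<ge> 1" "\<Lambda> k = 0"
    using zero unfolding is_initial_def by blast
  have "\<Lambda> 1 \<le> \<Lambda> k" using le[of 1 k] k by simp
  with k nonneg[of 1] show zero1: "\<Lambda> 1 = 0" by simp
  with lt[of 1 2] show pos: "\<Lambda> 2 > 0" by simp
  have init2: "is_initial \<Lambda> a 2" unfolding is_initial_def
  proof (intro conjI notI)
    assume "\<exists>n s. 1 \<le> n \<and> n < 2 \<and> 1 \<le> s \<and> a ^ s * \<Lambda> n = \<Lambda> 2"
    then obtain n s where "1 \<le> n" "n < (2::nat)" "a ^ s * \<Lambda> n = \<Lambda> 2" by blast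
    moreover from this have "n = 1" by simp
    ultimately show False using zero1 pos by simp
  qed simp
  have power: "\<exists>s. \<Lambda> n = a ^ s * \<Lambda> 2" if "n \<ge> 2" for n
    using that
  proof (induction n rule: less_induct)
    case (less n)
    show ?case
    proof (cases "n = 2")
      case True
      then show ?thesis by (intro exI[of _ 0]) simp
    next
      case False
      have "\<Lambda> n > 0" using less.prems lt[of 1 n] zero1 by simp
      then have "\<not> is_initial \<Lambda> a n"
        using nonzero init2 False pos by (metis less_irrefl)
      then obtain i s where i: "1 \<le> i" "i < n" "a ^ s * \<Lambda> i = \<Lambda> n"
        using less.prems unfolding is_initial_def by auto
      with \<open>\<Lambda> n > 0\<close> zero1 have "i \<noteq> 1" by auto
      with i less.IH[of i] obtain t where "\<Lambda> i = a ^ t * \<Lambda> 2" by auto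
      with i have "\<Lambda> n = a ^ (s + t) * \<Lambda> 2" by (simp add: power_add)
      then show ?thesis by blast
    qed
  qed
  show "\<Lambda> (n + 2) = a ^ n * \<Lambda> 2"
  proof (induction n)
    case (Suc n)
    obtain s where s: "\<Lambda> (Suc n + 2) = a ^ s * \<Lambda> 2" using power[of "Suc n + 2"] by auto
    have "a ^ n * \<Lambda> 2 < a ^ s * \<Lambda> 2"
      using lt[of "n + 2" "Suc n + 2"] Suc.IH s by simp
    then have "Suc n \<le> s" using pos a by (simp add: Suc_le_eq)
    then have "a ^ Suc n * \<Lambda> 2 \<le> \<Lambda> (Suc n + 2)"
      unfolding s using a pos by (intro mult_right_mono power_increasing) auto
    moreover obtain m where m: "m \<ge> 1" "\<Lambda> m = a * \<Lambda> (n + 2)" using closed[of "n + 2"] by auto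
    have "\<Lambda> (n + 2) < \<Lambda> m"
      using m a pos Suc.IH by simp
    then have "Suc n + 2 \<le> m" using lt[of "n + 2" m] m by simp
    then have "\<Lambda> (Suc n + 2) \<le> \<Lambda> m" using le[of "Suc n + 2" m] m by simp
    with m Suc.IH have "\<Lambda> (Suc n + 2) \<le> a ^ Suc n * \<Lambda> 2" by simp
    ultimately show ?case by simp
  qed (simp add: numeral_2_eq_2)
qed

section \<open>Affine composition operators on the Dirichlet space\<close>

text \<open>
  Distinct indices may give the same function, so coefficients are collected along the fibres of \<open>g\<close>.
\<close>

lemma fun_span_range_sum:
  assumes "finite J"
  shows "(\<lambda>z. \<Sum>j\<in>J. d j * g j z) \<in> fun_span (range g)"
proof -
  have "(\<Sum>j\<in>J. d j * g j z) = (\<Sum>f\<in>g ` J. (\<Sum>j\<in>{j\<in>J. g j = f}. d j) * f z)" for z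
  proof -
    have "(\<Sum>j\<in>J. d j * g j z) = (\<Sum>f\<in>g ` J. \<Sum>j\<in>{j\<in>J. g j = f}. d j * g j z)"
      using assms by (rule sum.image_gen)
    also have "\<dots> = (\<Sum>f\<in>g ` J. (\<Sum>j\<in>{j\<in>J. g j = f}. d j) * f z)"
      by (auto simp: sum_distrib_right intro!: sum.cong)
    finally show ?thesis .
  qed
  then show ?thesis
    using assms unfolding fun_span_def
    by (auto intro!: exI[of _ "g ` J"] exI[of _ "\<lambda>f. \<Sum>j\<in>{j\<in>J. g j = f}. d j"])
qed

locale weighted_dirichlet_space =
  fixes \<Lambda> \<beta> :: "nat \<Rightarrow> real"
  assumes mono: "strict_mono_on {1..} \<Lambda>"
    and unbounded: "filterlim \<Lambda> at_top sequentially"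
    and L_finite: "L_upper \<Lambda> < \<infinity>"
begin

abbreviation D :: "complex set" where "D \<equiv> dir_domain \<beta> \<Lambda>"

text \<open>
  The exponential \<open>E\<^sub>k\<close>, cut off outside the half-plane as the elements of the space are.
\<close>

definition monomial :: "nat \<Rightarrow> complex \<Rightarrow> complex" where
  "monomial k = (\<lambda>z. if z \<in> D then exp (- (of_real (\<Lambda> k) * z)) else 0)"

lemma strict_mono_Suc: "strict_mono (\<lambda>n. \<Lambda> (Suc n))"
  using mono by (auto simp: strict_mono_def strict_mono_on_def)

lemma eventually_real_in_domain: "\<exists>x0. \<forall>x\<ge>x0. of_real x \<in> D"
proof -
  obtain r where "D = half_plane r" unfolding dir_domain_def by blast
  then show ?thesis by (intro exI[of _ "r + 1"]) (auto simp: half_plane_def)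
qed

lemma is_dir_coeffs_unique:
  assumes c: "is_dir_coeffs \<beta> \<Lambda> f c" and c': "is_dir_coeffs \<beta> \<Lambda> f c'"
  shows "c = c'"
proof
  fix n
  show "c n = c' n"
  proof (cases n)
    case (Suc k)
    obtain s where s: "summable (\<lambda>n. exp (- (s * \<Lambda> (Suc n))))"
      using summable_exp_of_L_upper[OF unbounded L_finite] by blast
    obtain x0 where x0: "\<And>x. x \<ge> x0 \<Longrightarrow> of_real x \<in> D" using eventually_real_in_domain by blast
    have "(\<lambda>n. (c (Suc n) - c' (Suc n)) * exp (- (of_real (\<Lambda> (Suc n)) * of_real x)))
            sums (0 * exp (- (of_real (\<Lambda> (Suc k) + 1) * of_real x)))" if "x \<ge> x0" for x
    proof -
      have "(\<lambda>n. c (Suc n) * exp (- (of_real (\<Lambda> (Suc n)) * of_real x))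
              - c' (Suc n) * exp (- (of_real (\<Lambda> (Suc n)) * of_real x))) sums (f (of_real x) - f (of_real x))"
        using c c' x0[OF that] unfolding is_dir_coeffs_def by (intro sums_diff) auto
      then show ?thesis by (simp add: algebra_simps)
    qed
    from exp_series_coeff_below[OF strict_mono_Suc s this, where k = k] show ?thesis by (simp add: Suc)
  qed (use c c' in \<open>simp add: is_dir_coeffs_def\<close>)
qed

lemma dir_coeff_eq: "is_dir_coeffs \<beta> \<Lambda> f c \<Longrightarrow> dir_coeff \<beta> \<Lambda> f = c"
  unfolding dir_coeff_def using is_dir_coeffs_unique by blast

lemma dir_norm_eq:
  assumes c: "is_dir_coeffs \<beta> \<Lambda> f c"
  shows "dir_norm \<beta> \<Lambda> f = sqrt (\<Sum>n. (cmod (c (Suc n)))\<^sup>2 * (\<beta> (Suc n))\<^sup>2)"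
proof -
  let ?g = "\<lambda>n. (cmod (c (Suc n)))\<^sup>2 * (\<beta> (Suc n))\<^sup>2"
  have "summable ?g" using c by (simp add: is_dir_coeffs_def)
  then have "(\<lambda>n. complex_of_real (?g n)) sums of_real (suminf ?g)"
    by (intro sums_of_real summable_sums)
  moreover have "complex_of_real (?g n) = c (Suc n) * cnj (c (Suc n)) * of_real ((\<beta> (Suc n))\<^sup>2)" for n
    by (simp only: complex_norm_square[symmetric] of_real_mult of_real_power)
  ultimately have "(\<lambda>n. c (Suc n) * cnj (c (Suc n)) * of_real ((\<beta> (Suc n))\<^sup>2)) sums of_real (suminf ?g)"
    by (simp only:)
  then have "dir_inner \<beta> \<Lambda> f f = of_real (suminf ?g)"
    unfolding dir_inner_def dir_coeff_eq[OF c] by (rule sums_unique[symmetric])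
  then show ?thesis
    unfolding dir_norm_def by simp
qed

lemma monomial_coeffs:
  assumes "k \<ge> 1"
  shows "is_dir_coeffs \<beta> \<Lambda> (monomial k) (\<lambda>n. if n = k then 1 else 0)"
proof -
  obtain i where i: "k = Suc i" using assms by (cases k) auto
  have "(\<lambda>n. if n = i then (\<beta> (Suc n))\<^sup>2 else 0) sums (\<beta> (Suc i))\<^sup>2" by (rule sums_single)
  then have "summable (\<lambda>n. if n = i then (\<beta> (Suc n))\<^sup>2 else 0)" by (rule sums_summable)
  moreover have "(\<lambda>n. if n = i then exp (- (of_real (\<Lambda> (Suc n)) * z)) else 0)
                   sums exp (- (of_real (\<Lambda> (Suc i)) * z))" for z :: complex
    by (rule sums_single)
  ultimately show ?thesis
    unfolding is_dir_coeffs_def monomial_def i by (simp add: if_distrib[of "\<lambda>x. x * _"] if_distrib[of "\<lambda>x. x\<^sup>2"]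
      if_distrib[of cmod] cong: if_cong)
qed

lemma monomial_sum_in_dir_space: "(\<lambda>z. monomial 1 z + monomial 2 z) \<in> dir_space \<beta> \<Lambda>"
proof -
  let ?e = "\<lambda>k n :: nat. if n = k then 1 else 0 :: complex"
  have 1: "is_dir_coeffs \<beta> \<Lambda> (monomial 1) (?e 1)" and 2: "is_dir_coeffs \<beta> \<Lambda> (monomial 2) (?e 2)"
    by (rule monomial_coeffs, simp)+
  have "is_dir_coeffs \<beta> \<Lambda> (\<lambda>z. monomial 1 z + monomial 2 z) (\<lambda>n. ?e 1 n + ?e 2 n)"
    unfolding is_dir_coeffs_def
  proof (intro conjI ballI allI impI)
    show "summable (\<lambda>n. (cmod (?e 1 (Suc n) + ?e 2 (Suc n)))\<^sup>2 * (\<beta> (Suc n))\<^sup>2)"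
      by (rule summable_finite[of "{0, 1}"]) auto
    fix z assume z: "z \<in> D"
    have "(\<lambda>n. ?e 1 (Suc n) * exp (- (of_real (\<Lambda> (Suc n)) * z)) + ?e 2 (Suc n) * exp (- (of_real (\<Lambda> (Suc n)) * z)))
        sums (monomial 1 z + monomial 2 z)"
      using 1 2 z unfolding is_dir_coeffs_def by (intro sums_add) blast+
    then show "(\<lambda>n. (?e 1 (Suc n) + ?e 2 (Suc n)) * exp (- (of_real (\<Lambda> (Suc n)) * z)))
        sums (monomial 1 z + monomial 2 z)"
      by (simp only: distrib_right)
  qed (auto simp: monomial_def)
  then show ?thesis by (auto simp: dir_space_def)
qed

text \<open>
  The image of \<open>E\<^sub>k\<close> is a non-zero multiple of \<open>exp (- a * \<Lambda> k * z)\<close>.  It is also a Dirichlet series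
  over \<open>\<Lambda>\<close>, which is impossible unless \<open>a * \<Lambda> k\<close> occurs in \<open>\<Lambda>\<close>.
\<close>

lemma affine_frequency_closed:
  assumes maps: "affine_symbol a b ` D \<subseteq> D"
    and space: "comp_op D (affine_symbol a b) ` dir_space \<beta> \<Lambda> \<subseteq> dir_space \<beta> \<Lambda>"
    and k: "k \<ge> 1"
  shows "\<exists>m\<ge>1. \<Lambda> m = a * \<Lambda> k"
proof -
  have "monomial k \<in> dir_space \<beta> \<Lambda>" using monomial_coeffs[OF k] by (auto simp: dir_space_def)
  then obtain c where c: "is_dir_coeffs \<beta> \<Lambda> (comp_op D (affine_symbol a b) (monomial k)) c"
    using space unfolding dir_space_def by blast
  obtain s where s: "summable (\<lambda>n. exp (- (s * \<Lambda> (Suc n))))"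
    using summable_exp_of_L_upper[OF unbounded L_finite] by blast
  obtain x0 where x0: "\<And>x. x \<ge> x0 \<Longrightarrow> of_real x \<in> D" using eventually_real_in_domain by blast
  have "(\<lambda>n. c (Suc n) * exp (- (of_real (\<Lambda> (Suc n)) * of_real x)))
          sums (exp (- (of_real (\<Lambda> k) * b)) * exp (- (of_real (a * \<Lambda> k) * of_real x)))" if "x \<ge> x0" for x
  proof -
    have "comp_op D (affine_symbol a b) (monomial k) (of_real x)
        = exp (- (of_real (\<Lambda> k) * b)) * exp (- (of_real (a * \<Lambda> k) * of_real x))"
      using maps x0[OF that]
      by (auto simp: comp_op_def monomial_def affine_symbol_def exp_add[symmetric] algebra_simps)
    then show ?thesis using c x0[OF that] unfolding is_dir_coeffs_def by metis
  qed
  from exp_series_frequency[OF strict_mono_Suc s this] show ?thesis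
    by (metis exp_not_eq_zero le_add1 plus_1_eq_Suc)
qed

lemma comp_op_affine_monomial:
  assumes "affine_symbol a b ` D \<subseteq> D" and "\<Lambda> m = a * \<Lambda> k"
  shows "comp_op D (affine_symbol a b) (monomial k)
           = (\<lambda>z. exp (- (of_real (\<Lambda> k) * b)) * monomial m z)"
  using assms by (auto simp: comp_op_def monomial_def affine_symbol_def exp_add[symmetric] algebra_simps fun_eq_iff)

lemma comp_op_affine_orbit:
  assumes maps: "affine_symbol a b ` D \<subseteq> D" and zero: "\<Lambda> 1 = 0"
    and geom: "\<And>n. \<Lambda> (n + 3) = a * \<Lambda> (n + 2)"
  shows "(comp_op D (affine_symbol a b) ^^ j) (\<lambda>z. monomial 1 z + monomial 2 z)
           = (\<lambda>z. monomial 1 z + (\<Prod>k<j. exp (- (of_real (\<Lambda> (k + 2)) * b))) * monomial (j + 2) z)"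
proof (induction j)
  case (Suc j)
  let ?T = "comp_op D (affine_symbol a b)"
  have lin: "?T (\<lambda>z. f z + u * g z) = (\<lambda>z. ?T f z + u * ?T g z)" for f g u
    by (auto simp: comp_op_def)
  have "?T (monomial 1) = monomial 1"
    using comp_op_affine_monomial[OF maps, where k = 1 and m = 1] zero by simp
  moreover have "?T (monomial (j + 2))
      = (\<lambda>z. exp (- (of_real (\<Lambda> (j + 2)) * b)) * monomial (Suc j + 2) z)"
    using comp_op_affine_monomial[OF maps, where k = "j + 2" and m = "j + 3"] geom by (simp add: numeral_3_eq_3)
  ultimately show ?case using Suc.IH lin by (simp add: mult.assoc)
qed (simp add: numeral_2_eq_2)

lemma orbit_index_geometric:
  assumes "\<And>n. \<Lambda> (n + 3) = a * \<Lambda> (n + 2)" "k \<ge> 2"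
  shows "orbit_index \<Lambda> a k = Suc k"
  unfolding orbit_index_def
proof (rule the_equality)
  have *: "\<Lambda> (Suc k) = a * \<Lambda> k"
  proof -
    have "k - 2 + 2 = k" "k - 2 + 3 = Suc k" using assms(2) by auto
    then show ?thesis using assms(1)[of "k - 2"] by simp
  qed
  then show "k \<le> Suc k \<and> a * \<Lambda> k = \<Lambda> (Suc k)" by simp
  fix m assume "k \<le> m \<and> a * \<Lambda> k = \<Lambda> m"
  with * assms(2) strict_mono_on_eqD[OF mono] show "m = Suc k" by auto
qed

text \<open>
  The factors \<open>\<beta> (k + 1) / \<beta> k\<close> telescope.  So, up to the constant \<open>\<beta> 2\<close>, the product is the coefficient
  of \<open>E\<^sub>j\<^sub>+\<^sub>2\<close> in the orbit, scaled by the norm \<open>\<beta> (j + 2)\<close> of \<open>E\<^sub>j\<^sub>+\<^sub>2\<close>.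
\<close>

lemma r_weight_prod:
  assumes \<beta>: "\<And>n. n \<ge> 1 \<Longrightarrow> \<beta> n > 0" and geom: "\<And>n. \<Lambda> (n + 3) = a * \<Lambda> (n + 2)"
  shows "(\<Prod>k=2..j+1. r_weight \<beta> \<Lambda> a b k)
           = (\<Prod>k<j. exp (- (of_real (\<Lambda> (k + 2)) * b))) * of_real (\<beta> (j + 2) / \<beta> 2)"
proof (induction j)
  case 0
  then show ?case using \<beta>[of 2] by (simp add: numeral_2_eq_2)
next
  case (Suc j)
  have r: "r_weight \<beta> \<Lambda> a b (j + 2) = exp (- (of_real (\<Lambda> (j + 2)) * b)) * of_real (\<beta> (j + 3) / \<beta> (j + 2))"
    unfolding r_weight_def using orbit_index_geometric[OF geom, of "j + 2"] by (simp add: numeral_3_eq_3)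
  have "(\<Prod>k=2..Suc j+1. r_weight \<beta> \<Lambda> a b k)
      = (\<Prod>k=2..j+1. r_weight \<beta> \<Lambda> a b k) * r_weight \<beta> \<Lambda> a b (j + 2)"
    by simp
  also have "\<dots> = (\<Prod>k<Suc j. exp (- (of_real (\<Lambda> (k + 2)) * b)))
      * (of_real (\<beta> (j + 2) / \<beta> 2) * of_real (\<beta> (j + 3) / \<beta> (j + 2)))"
    unfolding Suc.IH r by (simp only: prod.lessThan_Suc mult_ac)
  also have "complex_of_real (\<beta> (j + 2) / \<beta> 2) * of_real (\<beta> (j + 3) / \<beta> (j + 2)) = of_real (\<beta> (Suc j + 2) / \<beta> 2)"
    using \<beta>[of "j + 2"] by (simp add: numeral_3_eq_3)
  finally show ?case .
qed

text \<open>
  The combination has coefficient \<open>\<Sum> d\<^sub>j\<close> at \<open>E\<^sub>1\<close>.  Matching it to \<open>c 1\<close> leaves an error on the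
  shifted part alone.
\<close>

lemma dir_norm_diff_monomials:
  assumes c: "is_dir_coeffs \<beta> \<Lambda> f c" and c1: "(\<Sum>j<K. d j) = c 1"
    and sm: "(\<lambda>j. (cmod (c (j + 2) - (if j < K then d j * u j else 0)))\<^sup>2 * (\<beta> (j + 2))\<^sup>2) sums S"
  shows "dir_norm \<beta> \<Lambda> (\<lambda>z. f z - (\<Sum>j<K. d j * (monomial 1 z + u j * monomial (j + 2) z))) = sqrt S"
proof -
  define e where "e n = (if n < 2 then 0 else c n - (if n - 2 < K then d (n - 2) * u (n - 2) else 0))" for n
  have e: "e 0 = 0" "e (Suc 0) = 0" "e (Suc (Suc j)) = c (j + 2) - (if j < K then d j * u j else 0)" for j
    by (auto simp: e_def)
  let ?G = "\<lambda>n. (cmod (e (Suc n)))\<^sup>2 * (\<beta> (Suc n))\<^sup>2"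
  have "(\<lambda>n. ?G (Suc n)) sums S" using sm by (simp add: e)
  then have G: "?G sums S" by (subst (asm) sums_Suc_iff) (simp add: e)
  have "is_dir_coeffs \<beta> \<Lambda> (\<lambda>z. f z - (\<Sum>j<K. d j * (monomial 1 z + u j * monomial (j + 2) z))) e"
    unfolding is_dir_coeffs_def
  proof (intro conjI ballI allI impI)
    fix z assume z: "z \<in> D"
    let ?x = "\<lambda>n. exp (- (of_real (\<Lambda> (Suc n)) * z))"
    define q where "q n = (case n of 0 \<Rightarrow> c 1 | Suc j \<Rightarrow> d j * u j)" for n
    have q: "q 0 = c 1" "q (Suc j) = d j * u j" for j by (auto simp: q_def)
    have "(\<lambda>n. if n \<in> {..<Suc K} then q n * ?x n else 0) sums (\<Sum>n<Suc K. q n * ?x n)"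
      by (rule sums_If_finite_set) simp
    also have "(\<Sum>n<Suc K. q n * ?x n) = (\<Sum>j<K. d j * (monomial 1 z + u j * monomial (j + 2) z))"
      unfolding sum.lessThan_Suc_shift q c1[symmetric] using z
      by (simp add: monomial_def sum_distrib_right sum.distrib algebra_simps)
    finally have "(\<lambda>n. c (Suc n) * ?x n - (if n \<in> {..<Suc K} then q n * ?x n else 0))
        sums (f z - (\<Sum>j<K. d j * (monomial 1 z + u j * monomial (j + 2) z)))"
      using c z unfolding is_dir_coeffs_def by (intro sums_diff) auto
    moreover have "c (Suc n) * ?x n - (if n \<in> {..<Suc K} then q n * ?x n else 0) = e (Suc n) * ?x n" for n
      by (cases n) (auto simp: e q algebra_simps)
    ultimately show "(\<lambda>n. e (Suc n) * ?x n)
        sums (f z - (\<Sum>j<K. d j * (monomial 1 z + u j * monomial (j + 2) z)))" by simp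
  qed (use c G in \<open>auto simp: e is_dir_coeffs_def monomial_def sums_iff\<close>)
  from dir_norm_eq[OF this] show ?thesis using G by (simp add: sums_iff)
qed

end

theorem corollary5p16:
  fixes \<Lambda> \<beta> :: "nat \<Rightarrow> real" and a :: real and b :: complex and w :: "nat \<Rightarrow> complex"
  assumes "strict_mono_on {1..} \<Lambda>"
    and "\<And>n. n \<ge> 1 \<Longrightarrow> \<Lambda> n \<ge> 0"
    and "filterlim \<Lambda> at_top sequentially"
    and "L_upper \<Lambda> < \<infinity>"
    and "\<And>n. n \<ge> 1 \<Longrightarrow> \<beta> n > 0"
    and "beta_star \<beta> \<Lambda> \<noteq> \<infinity>" and "beta_star \<beta> \<Lambda> \<noteq> - \<infinity>"
    and "a > 1"
    and "bounded_comp_op \<beta> \<Lambda> (affine_symbol a b)"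
    and "\<exists>!k. is_initial \<Lambda> a k \<and> \<Lambda> k = 0"
    and "\<exists>!k. is_initial \<Lambda> a k \<and> \<Lambda> k \<noteq> 0"
    and "\<And>j. j \<ge> 1 \<Longrightarrow> w j = (\<Prod>k=2..j+1. r_weight \<beta> \<Lambda> a b k)"
    and "\<not> summable (\<lambda>j. (cmod (inverse (w (Suc j))))\<^sup>2)"
  shows "cyclic_op \<beta> \<Lambda> (comp_op (dir_domain \<beta> \<Lambda>) (affine_symbol a b))"
proof -
  interpret weighted_dirichlet_space \<Lambda> \<beta>
    using assms(1,3,4) by unfold_locales
  let ?T = "comp_op D (affine_symbol a b)"
  have maps: "affine_symbol a b ` D \<subseteq> D" and space: "?T ` dir_space \<beta> \<Lambda> \<subseteq> dir_space \<beta> \<Lambda>"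
    using assms(9) by (auto simp: bounded_comp_op_def)
  note freq = geometric_frequencies[OF assms(1,2,8) affine_frequency_closed[OF maps space] assms(10,11)]
  have geom: "\<Lambda> (n + 3) = a * \<Lambda> (n + 2)" for n
    using freq(3)[of n] freq(3)[of "Suc n"] by (simp add: numeral_3_eq_3)
  define u where "u j = (\<Prod>k<j. exp (- (of_real (\<Lambda> (k + 2)) * b)))" for j
  define x where "x = (\<lambda>z. monomial 1 z + monomial 2 z)"
  have orbit: "(?T ^^ j) x = (\<lambda>z. monomial 1 z + u j * monomial (j + 2) z)" for j
    unfolding x_def u_def using maps freq(1) geom by (rule comp_op_affine_orbit)
  have div: "\<not> summable (\<lambda>j. 1 / (cmod (u j) * \<beta> (j + 2))\<^sup>2)"
  proof
    assume "summable (\<lambda>j. 1 / (cmod (u j) * \<beta> (j + 2))\<^sup>2)"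
    then have "summable (\<lambda>j. (\<beta> 2)\<^sup>2 * (1 / (cmod (u (Suc j)) * \<beta> (Suc j + 2))\<^sup>2))"
      by (intro summable_mult) (subst (asm) summable_Suc_iff[symmetric])
    moreover have "(cmod (inverse (w (Suc j))))\<^sup>2 = (\<beta> 2)\<^sup>2 * (1 / (cmod (u (Suc j)) * \<beta> (Suc j + 2))\<^sup>2)" for j
    proof -
      have "w (Suc j) = u (Suc j) * of_real (\<beta> (Suc j + 2) / \<beta> 2)"
        using r_weight_prod[OF assms(5) geom, where j = "Suc j" and b = b] assms(12)[of "Suc j"] by (simp only: u_def)
      then have "cmod (w (Suc j)) = cmod (u (Suc j)) * (\<beta> (Suc j + 2) / \<beta> 2)"
        using assms(5)[of 2] assms(5)[of "Suc j + 2"] by (simp only: norm_mult norm_of_real) simp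
      then show ?thesis
        by (simp add: norm_inverse power_mult_distrib power_divide power_inverse divide_inverse mult_ac)
    qed
    ultimately show False using assms(13) by simp
  qed
  have "x \<in> dir_space \<beta> \<Lambda>"
    unfolding x_def by (rule monomial_sum_in_dir_space)
  moreover have "\<exists>p\<in>fun_span (op_orbit ?T x). dir_norm \<beta> \<Lambda> (\<lambda>z. f z - p z) < \<epsilon>"
    if f: "f \<in> dir_space \<beta> \<Lambda>" and \<epsilon>: "\<epsilon> > 0" for f \<epsilon>
  proof -
    obtain c where c: "is_dir_coeffs \<beta> \<Lambda> f c" using f by (auto simp: dir_space_def)
    then have "summable (\<lambda>n. (cmod (c (Suc n)))\<^sup>2 * (\<beta> (Suc n))\<^sup>2)" by (simp add: is_dir_coeffs_def)
    then have sm: "summable (\<lambda>j. (cmod (c (j + 2)))\<^sup>2 * (\<beta> (j + 2))\<^sup>2)"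
      by (subst (asm) summable_Suc_iff[symmetric]) simp
    obtain K d S where KdS: "(\<Sum>j<K. d j) = c 1" "S < \<epsilon>\<^sup>2"
      "(\<lambda>j. (cmod (c (j + 2) - (if j < K then d j * u j else 0)))\<^sup>2 * (\<beta> (j + 2))\<^sup>2) sums S"
      using constrained_weighted_approximation[OF _ _ div sm, of "\<epsilon>\<^sup>2" "c 1"] assms(5) \<epsilon>
      by (auto simp: u_def)
    define p where "p = (\<lambda>z. \<Sum>j<K. d j * (?T ^^ j) x z)"
    have "p \<in> fun_span (op_orbit ?T x)"
      unfolding p_def op_orbit_def by (rule fun_span_range_sum) simp
    moreover have "dir_norm \<beta> \<Lambda> (\<lambda>z. f z - p z) = sqrt S"
      unfolding p_def orbit using c KdS(1,3) by (rule dir_norm_diff_monomials)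
    moreover have "sqrt S < \<epsilon>" using KdS(2) \<epsilon> real_sqrt_less_mono[of S "\<epsilon>\<^sup>2"] by simp
    ultimately show ?thesis by (intro bexI[of _ p]) simp_all
  qed
  ultimately show ?thesis unfolding cyclic_op_def by blast
qed

end
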